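(* Let $n\geq 2$. For any $f\in C_0(\mathbb{Z}^n)$, $$\|f\|_{\frac{n}{n-1}}\leq\frac12\prod_{i=1}^n\|\partial_i f\|_1^{\frac1n}.$$ Moreover, equality holds if and only if $f=\lambda\cdot\chi_A$ for some $\lambda\in\mathbb{R}$ and some cuboid $A$ in $\mathbb{Z}^n$.
   Context: $C_0(\mathbb{Z}^n)$ denotes the space of real-valued functions on $\mathbb{Z}^n$ with finite support. For $p>0$ and $f\in C_0(\mathbb{Z}^n)$, $\|f\|_p:=\left(\sum_{z\in\mathbb{Z}^n}|f(z)|^p\right)^{1/p}$ (integration with respect to the counting measure). For $i=1,\dots,n$, $\partial_i f(z):=f(z+e_i)-f(z)$ for $z\in\mathbb{Z}^n$, where $e_i\in\mathbb{Z}^n$ is the vector whose $i$-th component is $1$ and whose other components are $0$. $\chi_A$ is the indicator function of $A$. A cuboid in $\mathbb{Z}^n$ is a set of the form $A=\prod_{i=1}^n[a_i,b_i]$ with $a_i,b_i\in\mathbb{Z}$, $a_i\leq b_i$, where $[a,b]=\{z\in\mathbb{Z} : a\leq z\leq b\}$. *)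

theory Defs
  imports "HOL-Analysis.Analysis"
begin

text \<open>
  The lattice \<open>\<int>\<^sup>n\<close> is the type \<open>int ^ 'n\<close> with \<open>n = CARD('n)\<close>; the vector
  \<open>e\<^sub>i\<close> is \<open>axis i 1\<close>.
\<close>

definition C0 :: "('a \<Rightarrow> real) set" where
  "C0 = {f. finite {z. f z \<noteq> 0}}"

text \<open>
  Intended for exponents \<open>p > 0\<close>. On \<open>C0\<close> only finitely many summands are nonzero (as
  \<open>0 powr p = 0\<close>), so the convention that \<open>infsum\<close> is 0 for non-summable
  families plays no role.
\<close>

definition lp_norm :: "real \<Rightarrow> ('a \<Rightarrow> real) \<Rightarrow> real" where
  "lp_norm p f = (\<Sum>\<^sub>\<infinity>z\<in>UNIV. \<bar>f z\<bar> powr p) powr (1 / p)"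

definition partial_diff :: "'n \<Rightarrow> (int ^ 'n \<Rightarrow> real) \<Rightarrow> (int ^ 'n \<Rightarrow> real)" where
  "partial_diff i f = (\<lambda>z. f (z + axis i 1) - f z)"

definition is_cuboid :: "(int ^ 'n) set \<Rightarrow> bool" where
  "is_cuboid A \<longleftrightarrow>
     (\<exists>a b. (\<forall>i. a $ i \<le> b $ i) \<and> A = {z. \<forall>i. z $ i \<in> {a $ i..b $ i}})"

end

theory Submission
  imports Defs
begin

text \<open>
  Let \<open>g i z\<close> be half the total variation of \<open>f\<close> along the line through \<open>z\<close> in direction \<open>i\<close>. Then
  \<open>\<bar>f\<bar> \<le> g i\<close> for every \<open>i\<close>, so \<open>\<bar>f\<bar>\<close> to the power \<open>n / (n - 1)\<close> is at most the product of the
  \<open>g i\<close> to the power \<open>1 / (n - 1)\<close>. As \<open>g i\<close> does not depend on the \<open>i\<close>-th coordinate, summing over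
  one coordinate after another with Hoelder's inequality (Gagliardo's argument) gives the inequality.

  In case of equality, comparing with the Loomis--Whitney inequality on single slices shows that
  \<open>\<bar>f\<bar> = g i\<close> on every slice orthogonal to \<open>i\<close> that meets the support of \<open>f\<close>. Hence along each line
  \<open>f\<close> varies no more than it must to reach its values and return to 0, which makes it constant between
  any two coordinates taken in the support. Changing the coordinates one at a time yields a cuboid.
\<close>

section \<open>Sums over coordinate boxes\<close>

definition upd :: "'a ^ 'n \<Rightarrow> 'n \<Rightarrow> 'a \<Rightarrow> 'a ^ 'n" where
  "upd z i t = (\<chi> k. if k = i then t else z $ k)"

text \<open>Coordinates outside \<open>I\<close> stay frozen at those of \<open>z\<close>, so all
  partial sums live on the same vector type and summing over one coordinate after another becomes an
  induction on \<open>I\<close>.\<close>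

definition box_at :: "'a set \<Rightarrow> 'n set \<Rightarrow> 'a ^ 'n \<Rightarrow> ('a ^ 'n) set" where
  "box_at K I z = {w. \<forall>k. if k \<in> I then w $ k \<in> K else w $ k = z $ k}"

definition box_sum :: "'a set \<Rightarrow> 'n set \<Rightarrow> ('a ^ 'n \<Rightarrow> real) \<Rightarrow> 'a ^ 'n \<Rightarrow> real" where
  "box_sum K I g z = (\<Sum>w\<in>box_at K I z. g w)"

lemma upd_nth [simp]: "upd z i t $ k = (if k = i then t else z $ k)"
  by (simp add: upd_def)

lemma upd_same [simp]: "upd z i (z $ i) = z"
  by (simp add: vec_eq_iff)

lemma upd_upd [simp]: "upd (upd z i s) i t = upd z i t"
  by (simp add: vec_eq_iff)

lemma box_at_nth: "w \<in> box_at K I z \<Longrightarrow> i \<notin> I \<Longrightarrow> w $ i = z $ i"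
  by (auto simp: box_at_def split: if_splits)

lemma box_at_empty [simp]: "box_at K {} z = {z}"
  by (auto simp: box_at_def vec_eq_iff)

lemma finite_box_at:
  fixes z :: "'a ^ 'n"
  assumes "finite K"
  shows "finite (box_at K I z)"
proof (rule inj_on_finite[where f = vec_nth])
  show "inj_on vec_nth (box_at K I z)"
    by (auto simp: inj_on_def vec_eq_iff)
  show "vec_nth ` box_at K I z \<subseteq> PiE UNIV (\<lambda>k. K \<union> {z $ k})"
    by (auto simp: box_at_def split: if_splits)
  show "finite (PiE (UNIV :: 'n set) (\<lambda>k. K \<union> {z $ k}))"
    by (rule finite_PiE) (use assms in auto)
qed

lemma box_sum_cong:
  "(\<And>w. w \<in> box_at K I z \<Longrightarrow> g w = h w) \<Longrightarrow> box_sum K I g z = box_sum K I h z"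
  by (simp add: box_sum_def)

lemma box_sum_mono:
  "(\<And>w. w \<in> box_at K I z \<Longrightarrow> g w \<le> h w) \<Longrightarrow> box_sum K I g z \<le> box_sum K I h z"
  by (simp add: box_sum_def sum_mono)

lemma box_sum_nonneg: "(\<And>w. 0 \<le> g w) \<Longrightarrow> 0 \<le> box_sum K I g z"
  by (simp add: box_sum_def sum_nonneg)

text \<open>Coordinate \<open>i\<close> is frozen on the box, so overwriting it carries one box
  bijectively onto the other.\<close>

lemma box_sum_upd:
  assumes "i \<notin> I"
  shows "box_sum K I g (upd z i t) = box_sum K I (\<lambda>w. g (upd w i t)) z"
proof -
  have idem: "upd w i t = w" if "w \<in> box_at K I (upd z i t)" for w
    using box_at_nth[OF that assms] upd_same[of w i] by simp
  have idem': "upd w i (z $ i) = w" if "w \<in> box_at K I z" for w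
    using box_at_nth[OF that assms] upd_same[of w i] by simp
  have mem: "upd w i (z $ i) \<in> box_at K I z" if "w \<in> box_at K I (upd z i t)" for w
    using that assms by (simp add: box_at_def)
  have mem': "upd w i t \<in> box_at K I (upd z i t)" if "w \<in> box_at K I z" for w
    using that assms by (simp add: box_at_def)
  show ?thesis
    unfolding box_sum_def
    by (rule sum.reindex_bij_witness[where i = "\<lambda>w. upd w i t" and j = "\<lambda>w. upd w i (z $ i)"])
      (simp_all add: idem idem' mem mem')
qed

text \<open>Fubini with the new coordinate innermost; the primed version puts it outermost, which is
  the form for cutting a box into slices.\<close>

lemma box_sum_insert:
  assumes "i \<notin> I"
  shows "box_sum K (insert i I) g z = box_sum K I (\<lambda>w. \<Sum>t\<in>K. g (upd w i t)) z"
proof -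
  have "box_sum K (insert i I) g z = (\<Sum>(w, t)\<in>box_at K I z \<times> K. g (upd w i t))"
    unfolding box_sum_def
    by (rule sum.reindex_bij_witness
        [where i = "\<lambda>(w, t). upd w i t" and j = "\<lambda>v. (upd v i (z $ i), v $ i)"])
      (use assms in \<open>fastforce simp: box_at_def vec_eq_iff split: if_splits\<close>)+
  then show ?thesis
    by (simp add: box_sum_def sum.cartesian_product)
qed

lemma box_sum_insert':
  assumes "i \<notin> I"
  shows "box_sum K (insert i I) g z = (\<Sum>t\<in>K. box_sum K I g (upd z i t))"
proof -
  have "(\<Sum>t\<in>K. box_sum K I g (upd z i t)) = (\<Sum>t\<in>K. box_sum K I (\<lambda>w. g (upd w i t)) z)"
    using assms by (simp add: box_sum_upd)
  also have "\<dots> = box_sum K (insert i I) g z"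
    unfolding box_sum_insert[OF assms] by (simp add: box_sum_def sum.swap[of _ K])
  finally show ?thesis ..
qed

lemma box_sum_prod:
  fixes \<phi> :: "'n::finite \<Rightarrow> 'a \<Rightarrow> real"
  shows "box_sum K I (\<lambda>w. \<Prod>j\<in>I. \<phi> j (w $ j)) z = (\<Prod>j\<in>I. \<Sum>t\<in>K. \<phi> j t)"
proof -
  have "finite I" by simp
  then show ?thesis
  proof (induction I)
    case empty
    then show ?case by (simp add: box_sum_def)
  next
    case (insert i I)
    have "(\<Sum>t\<in>K. \<Prod>j\<in>insert i I. \<phi> j (upd w i t $ j))
        = (\<Sum>t\<in>K. \<phi> i t) * (\<Prod>j\<in>I. \<phi> j (w $ j))" for w
    proof -
      have "(\<Prod>j\<in>insert i I. \<phi> j (upd w i t $ j)) = \<phi> i t * (\<Prod>j\<in>I. \<phi> j (w $ j))" for t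
      proof -
        have "(\<Prod>j\<in>I. \<phi> j (upd w i t $ j)) = (\<Prod>j\<in>I. \<phi> j (w $ j))"
          using insert by (intro prod.cong) auto
        then show ?thesis
          using insert by simp
      qed
      then show ?thesis
        by (simp add: sum_distrib_right)
    qed
    then have "box_sum K (insert i I) (\<lambda>w. \<Prod>j\<in>insert i I. \<phi> j (w $ j)) z
        = box_sum K I (\<lambda>w. (\<Sum>t\<in>K. \<phi> i t) * (\<Prod>j\<in>I. \<phi> j (w $ j))) z"
      by (simp only: box_sum_insert[OF insert.hyps(2)])
    also have "\<dots> = (\<Sum>t\<in>K. \<phi> i t) * box_sum K I (\<lambda>w. \<Prod>j\<in>I. \<phi> j (w $ j)) z"
      by (simp add: box_sum_def sum_distrib_left)
    finally show ?case
      using insert by simp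
  qed
qed

section \<open>The Loomis--Whitney inequality\<close>

lemma prod_powr:
  fixes x :: "'a \<Rightarrow> real"
  assumes "\<And>j. j \<in> J \<Longrightarrow> 0 \<le> x j"
  shows "(\<Prod>j\<in>J. x j powr r) = (\<Prod>j\<in>J. x j) powr r"
  using assms by (induction J rule: infinite_finite_induct) (auto simp: powr_mult prod_nonneg)

text \<open>Hoelder with \<open>card J\<close> equal exponents: once each \<open>a j\<close> is
  divided by its total \<open>S j\<close>, the pointwise inequality of arithmetic and geometric
  means bounds the remaining sum by 1.\<close>

lemma generalized_Hoelder_sum:
  fixes a :: "'j \<Rightarrow> 't \<Rightarrow> real"
  assumes J: "finite J" "J \<noteq> {}" and K: "finite K"
    and a: "\<And>j t. 0 \<le> a j t"
  shows "(\<Sum>t\<in>K. \<Prod>j\<in>J. a j t powr (1 / card J)) \<le> (\<Prod>j\<in>J. (\<Sum>t\<in>K. a j t) powr (1 / card J))"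
proof -
  define r where "r = 1 / real (card J)"
  define S where "S j = (\<Sum>t\<in>K. a j t)" for j
  have S: "0 \<le> S j" for j
    by (simp add: S_def a sum_nonneg)
  have card: "0 < real (card J)"
    using J by (simp add: card_gt_0_iff)
  have zero: "a j t = 0" if "S j = 0" "t \<in> K" for j t
    using that K a by (simp add: S_def sum_nonneg_eq_0_iff)
  have "(\<Sum>t\<in>K. \<Prod>j\<in>J. a j t powr r)
      = (\<Sum>t\<in>K. (\<Prod>j\<in>J. S j powr r) * (\<Prod>j\<in>J. a j t / S j) powr r)"
  proof (rule sum.cong[OF refl])
    fix t assume t: "t \<in> K"
    \<comment> \<open>If \<open>S j = 0\<close>, every \<open>a j t\<close> with \<open>t\<close> in
      \<open>K\<close> is 0 and both sides vanish, division by zero giving 0.\<close>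
    have "a j t powr r = S j powr r * (a j t / S j) powr r" for j
      using zero[OF _ t] by (cases "S j = 0") (auto simp: powr_divide S a)
    then have "(\<Prod>j\<in>J. a j t powr r) = (\<Prod>j\<in>J. S j powr r * (a j t / S j) powr r)"
      by simp
    also have "\<dots> = (\<Prod>j\<in>J. S j powr r) * (\<Prod>j\<in>J. (a j t / S j) powr r)"
      by (simp add: prod.distrib)
    finally show "(\<Prod>j\<in>J. a j t powr r) = (\<Prod>j\<in>J. S j powr r) * (\<Prod>j\<in>J. a j t / S j) powr r"
      by (simp add: prod_powr S a)
  qed
  also have "\<dots> = (\<Prod>j\<in>J. S j powr r) * (\<Sum>t\<in>K. (\<Prod>j\<in>J. a j t / S j) powr r)"
    by (simp add: sum_distrib_left)
  also have "\<dots> \<le> (\<Prod>j\<in>J. S j powr r) * 1"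
  proof (rule mult_left_mono)
    have "(\<Sum>t\<in>K. (\<Prod>j\<in>J. a j t / S j) powr r) \<le> (\<Sum>t\<in>K. \<Sum>j\<in>J. a j t / S j / card J)"
      unfolding r_def by (intro sum_mono arith_geom_mean) (use J a S in auto)
    also have "\<dots> = (\<Sum>j\<in>J. (\<Sum>t\<in>K. a j t) / S j / card J)"
      by (subst sum.swap) (simp add: sum_divide_distrib)
    \<comment> \<open>Each quotient is 1, or 0 when \<open>S j = 0\<close>, hence only an
      inequality.\<close>
    also have "\<dots> \<le> (\<Sum>j\<in>J. 1 / card J)"
      using card by (intro sum_mono divide_right_mono) (auto simp: S_def)
    also have "\<dots> = 1"
      using card by simp
    finally show "(\<Sum>t\<in>K. (\<Prod>j\<in>J. a j t / S j) powr r) \<le> 1" .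
  qed (simp add: prod_nonneg)
  finally show ?thesis
    by (simp add: r_def S_def)
qed

text \<open>The \<open>i\<close>-th factor is constant in \<open>t\<close> and comes out of the sum.
  This leaves \<open>n - 1\<close> factors with exponent \<open>1 / (n - 1)\<close>, exactly the
  situation of Hoelder's inequality.\<close>

lemma Loomis_Whitney_step:
  fixes g :: "'n \<Rightarrow> 'a ^ 'n \<Rightarrow> real"
  assumes n: "CARD('n) \<ge> 2" and K: "finite K"
    and nonneg: "\<And>j w. 0 \<le> g j w"
    and indep: "\<And>j w t. g j (upd w j t) = g j w"
    and i: "i \<notin> I"
  defines "r \<equiv> 1 / (real CARD('n) - 1)"
  shows "(\<Sum>t\<in>K. \<Prod>j\<in>UNIV. box_sum K (I - {j}) (g j) (upd z i t) powr r)
       \<le> (\<Prod>j\<in>UNIV. box_sum K (insert i I - {j}) (g j) z powr r)"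
proof -
  define J where "J = UNIV - {i}"
  have card: "card J = CARD('n) - 1"
    by (simp add: J_def)
  then have r: "r = 1 / real (card J)"
    using n by (simp add: r_def of_nat_diff)
  have "card J \<noteq> 0"
    using n card by simp
  then have J: "finite J" "J \<noteq> {}"
    by (simp_all add: card_eq_0_iff)
  have split: "(\<Prod>j\<in>UNIV. x j) = x i * (\<Prod>j\<in>J. x j)" for x :: "'n \<Rightarrow> real"
    unfolding J_def by (rule prod.remove) auto
  have I: "I - {i} = I" "insert i I - {i} = I"
    using i by auto
  have ins: "insert i I - {j} = insert i (I - {j})" if "j \<in> J" for j
    using that by (auto simp: J_def)
  have const: "box_sum K I (g i) (upd z i t) = box_sum K I (g i) z" for t
    using i by (simp add: box_sum_upd indep)
  have "(\<Sum>t\<in>K. \<Prod>j\<in>UNIV. box_sum K (I - {j}) (g j) (upd z i t) powr r)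
      = box_sum K I (g i) z powr r
          * (\<Sum>t\<in>K. \<Prod>j\<in>J. box_sum K (I - {j}) (g j) (upd z i t) powr r)"
    by (simp add: split I const sum_distrib_left)
  also have "\<dots> \<le> box_sum K I (g i) z powr r
          * (\<Prod>j\<in>J. (\<Sum>t\<in>K. box_sum K (I - {j}) (g j) (upd z i t)) powr r)"
    unfolding r
    by (rule mult_left_mono[OF generalized_Hoelder_sum[OF J K]])
      (simp_all add: box_sum_nonneg nonneg)
  also have "\<dots> = (\<Prod>j\<in>UNIV. box_sum K (insert i I - {j}) (g j) z powr r)"
  proof -
    have "(\<Sum>t\<in>K. box_sum K (I - {j}) (g j) (upd z i t)) = box_sum K (insert i I - {j}) (g j) z"
      if "j \<in> J" for j
      unfolding ins[OF that] using i by (subst box_sum_insert') auto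
    then show ?thesis
      by (simp add: split I)
  qed
  finally show ?thesis .
qed

text \<open>Coordinate \<open>j\<close> is left out of the \<open>j\<close>-th sum because
  \<open>g j\<close> does not depend on it. A general \<open>I\<close> serves the induction and also
  the later use on slices, where \<open>I = UNIV - {i}\<close>.\<close>

lemma Loomis_Whitney:
  fixes g :: "'n \<Rightarrow> 'a ^ 'n \<Rightarrow> real"
  assumes n: "CARD('n) \<ge> 2" and K: "finite K"
    and nonneg: "\<And>j w. 0 \<le> g j w"
    and indep: "\<And>j w t. g j (upd w j t) = g j w"
  defines "r \<equiv> 1 / (real CARD('n) - 1)"
  shows "box_sum K I (\<lambda>w. \<Prod>j\<in>UNIV. g j w powr r) z
       \<le> (\<Prod>j\<in>UNIV. box_sum K (I - {j}) (g j) z powr r)"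
proof -
  have "finite I" by simp
  then show ?thesis
  proof (induction I arbitrary: z)
    case empty
    then show ?case by (simp add: box_sum_def)
  next
    case (insert i I)
    have "box_sum K (insert i I) (\<lambda>w. \<Prod>j\<in>UNIV. g j w powr r) z
        \<le> (\<Sum>t\<in>K. \<Prod>j\<in>UNIV. box_sum K (I - {j}) (g j) (upd z i t) powr r)"
      using insert by (simp add: box_sum_insert' sum_mono)
    also have "\<dots> \<le> (\<Prod>j\<in>UNIV. box_sum K (insert i I - {j}) (g j) z powr r)"
      unfolding r_def using insert by (intro Loomis_Whitney_step n K nonneg indep) auto
    finally show ?case .
  qed
qed

section \<open>Functions dominated by every factor, and their case of equality\<close>

lemma powr_eq_prod_powr:
  assumes n: "CARD('n) \<ge> 2" and "0 \<le> (x::real)"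
  shows "x powr (real CARD('n) / (real CARD('n) - 1))
       = (\<Prod>j\<in>(UNIV :: 'n::finite set). x powr (1 / (real CARD('n) - 1)))"
  using assms by (cases "x = 0") (auto simp: powr_power)

lemma powr_le_prod_powr:
  fixes g :: "'n::finite \<Rightarrow> real"
  assumes n: "CARD('n) \<ge> 2" and "0 \<le> x" "\<And>j. x \<le> g j"
  shows "x powr (real CARD('n) / (real CARD('n) - 1))
       \<le> (\<Prod>j\<in>UNIV. g j powr (1 / (real CARD('n) - 1)))"
  unfolding powr_eq_prod_powr[OF n \<open>0 \<le> x\<close>]
  by (intro prod_mono) (use assms in \<open>auto intro!: powr_mono2\<close>)

lemma Loomis_Whitney_dominated:
  fixes g :: "'n \<Rightarrow> 'a ^ 'n \<Rightarrow> real"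
  assumes n: "CARD('n) \<ge> 2" and K: "finite K"
    and indep: "\<And>j w t. g j (upd w j t) = g j w"
    and F: "\<And>w. 0 \<le> F w" "\<And>j w. F w \<le> g j w"
  shows "box_sum K I (\<lambda>w. F w powr (real CARD('n) / (real CARD('n) - 1))) z
       \<le> (\<Prod>j\<in>UNIV. box_sum K (I - {j}) (g j) z powr (1 / (real CARD('n) - 1)))"
proof -
  have "0 \<le> g j w" for j w
    using F order_trans by blast
  note LW = Loomis_Whitney[OF n K this indep]
  show ?thesis
    by (rule order_trans[OF _ LW]) (intro box_sum_mono powr_le_prod_powr n F)
qed

text \<open>Equality forces equality on each slice orthogonal to \<open>i\<close>. On a slice where \<open>F\<close> does not
  vanish, the inequality still holds with \<open>F\<close> itself in place of the larger \<open>g i\<close>, so the two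
  have the same sum over the slice.\<close>

lemma Loomis_Whitney_dominated_equality:
  fixes g :: "'n \<Rightarrow> 'a ^ 'n \<Rightarrow> real"
  assumes n: "CARD('n) \<ge> 2" and K: "finite K"
    and indep: "\<And>j w t. g j (upd w j t) = g j w"
    and F: "\<And>w. 0 \<le> F w" "\<And>j w. F w \<le> g j w"
    and eq: "box_sum K UNIV (\<lambda>w. F w powr (real CARD('n) / (real CARD('n) - 1))) z0
       = (\<Prod>j\<in>UNIV. box_sum K (UNIV - {j}) (g j) z0 powr (1 / (real CARD('n) - 1)))"
    and z: "\<And>k. z $ k \<in> K" and v: "\<And>k. v $ k \<in> K" "v $ i = z $ i" and Fz: "F z \<noteq> 0"
  shows "F v = g i v"
proof -
  define r where "r = 1 / (real CARD('n) - 1)"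
  define p where "p = real CARD('n) / (real CARD('n) - 1)"
  define I where "I = UNIV - {i}"
  define L where "L t = box_sum K I (\<lambda>w. F w powr p) (upd z0 i t)" for t
  define R where "R t = (\<Prod>j\<in>UNIV. box_sum K (I - {j}) (g j) (upd z0 i t) powr r)" for t
  define y where "y = upd z0 i (z $ i)"
  \<comment> \<open>The factors of the slice other than the \<open>i\<close>-th; they are shared by
    \<open>g\<close> and the modified family \<open>g'\<close>.\<close>
  define P where "P = (\<Prod>j\<in>I. box_sum K (I - {j}) (g j) y powr r)"
  have r: "0 < r"
    using n by (simp add: r_def)
  have g: "0 \<le> g j w" for j w
    using F order_trans by blast
  have I: "i \<notin> I" "insert i I = UNIV" "I - {i} = I"
    by (auto simp: I_def)
  have box: "w \<in> box_at K I y \<longleftrightarrow> w $ i = z $ i \<and> (\<forall>k. k \<noteq> i \<longrightarrow> w $ k \<in> K)" for w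
    by (auto simp: box_at_def I_def y_def)
  have split: "(\<Prod>j\<in>UNIV. x j) = x i * (\<Prod>j\<in>I. x j)" for x :: "'n \<Rightarrow> real"
    unfolding I_def by (rule prod.remove) auto
  have LR: "L t \<le> R t" for t
    unfolding L_def R_def p_def r_def by (intro Loomis_Whitney_dominated n K indep F)
  \<comment> \<open>The Hoelder step leads from the slice bounds back to the right-hand side of
    \<open>eq\<close>, so no bound \<open>L t \<le> R t\<close> with \<open>t\<close> in
    \<open>K\<close> can be strict.\<close>
  have "(\<Sum>t\<in>K. R t) \<le> (\<Prod>j\<in>UNIV. box_sum K (insert i I - {j}) (g j) z0 powr r)"
    unfolding R_def r_def by (intro Loomis_Whitney_step n K g indep I)
  also have "\<dots> = (\<Sum>t\<in>K. L t)"
    using eq by (simp add: I(2) p_def r_def L_def flip: box_sum_insert'[OF I(1)])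
  finally have "(\<Sum>t\<in>K. L t) = (\<Sum>t\<in>K. R t)"
    using LR by (simp add: antisym sum_mono)
  then have "L (z $ i) = R (z $ i)"
    using LR z K by (intro sum_mono_inv[of L K R]) auto
  then have slice: "box_sum K I (\<lambda>w. F w powr p) y = box_sum K I (g i) y powr r * P"
    unfolding L_def R_def P_def split by (simp add: I y_def)
  \<comment> \<open>Freezing coordinate \<open>i\<close> of \<open>F\<close> at the slice makes it
    independent of that coordinate, hence an admissible \<open>i\<close>-th factor that agrees with
    \<open>F\<close> on the slice.\<close>
  define g' where "g' j = (if j = i then (\<lambda>w. F (upd w i (z $ i))) else g j)" for j
  have "box_sum K I (\<lambda>w. F w powr p) y = box_sum K I (\<lambda>w. F (upd w i (z $ i)) powr p) y"
    by (rule box_sum_cong) (metis box upd_same)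
  also have "\<dots> \<le> box_sum K I (\<lambda>w. \<Prod>j\<in>UNIV. g' j w powr r) y"
  proof (rule box_sum_mono)
    fix w assume "w \<in> box_at K I y"
    then have "upd w i (z $ i) = w"
      by (metis box upd_same)
    then show "F (upd w i (z $ i)) powr p \<le> (\<Prod>j\<in>UNIV. g' j w powr r)"
      unfolding p_def r_def by (intro powr_le_prod_powr n) (auto simp: F g'_def)
  qed
  also have "\<dots> \<le> (\<Prod>j\<in>UNIV. box_sum K (I - {j}) (g' j) y powr r)"
    unfolding r_def by (intro Loomis_Whitney n K) (auto simp: g'_def F g indep)
  also have "\<dots> = box_sum K I (g' i) y powr r * P"
  proof -
    have "(\<Prod>j\<in>I. box_sum K (I - {j}) (g' j) y powr r) = P"
      unfolding P_def by (rule prod.cong) (auto simp: g'_def I_def)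
    then show ?thesis
      by (simp add: split I)
  qed
  also have "box_sum K I (g' i) y = box_sum K I F y"
    by (rule box_sum_cong) (metis box upd_same g'_def)
  finally have le: "box_sum K I (g i) y powr r * P \<le> box_sum K I F y powr r * P"
    by (simp add: slice)
  have zv: "z \<in> box_at K I y" "v \<in> box_at K I y"
    using z v by (auto simp: box)
  \<comment> \<open>The point \<open>z\<close> makes the slice sum positive, so \<open>P\<close> is
    positive and cancels from \<open>le\<close>.\<close>
  have "0 < F z powr p"
    using Fz by simp
  also have "\<dots> \<le> box_sum K I (\<lambda>w. F w powr p) y"
    unfolding box_sum_def by (rule member_le_sum) (use zv K in \<open>auto simp: finite_box_at\<close>)
  finally have "0 < box_sum K I (g i) y powr r * P"
    by (simp add: slice)
  moreover have "0 \<le> P"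
    by (simp add: P_def prod_nonneg)
  ultimately have "0 < P"
    by (simp add: zero_less_mult_iff)
  with le have "box_sum K I (g i) y powr r \<le> box_sum K I F y powr r"
    by simp
  moreover have "0 \<le> box_sum K I F y"
    by (simp add: box_sum_nonneg F)
  ultimately have "box_sum K I (g i) y \<le> box_sum K I F y"
    using r powr_less_mono2[of r "box_sum K I F y" "box_sum K I (g i) y"] by linarith
  then have "box_sum K I F y = box_sum K I (g i) y"
    using F by (simp add: antisym box_sum_mono)
  then show ?thesis
    unfolding box_sum_def using F zv K
    by (intro sum_mono_inv[of F "box_at K I y" "g i"]) (auto simp: finite_box_at)
qed

section \<open>Total variation on a line\<close>

lemma sum_differences:
  fixes \<phi> :: "int \<Rightarrow> real"
  assumes "a \<le> b"
  shows "(\<Sum>t\<in>{a..<b}. \<phi> (t + 1) - \<phi> t) = \<phi> b - \<phi> a"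
  using assms
proof (induction b rule: int_ge_induct)
  case (step b)
  then have "{a..<b + 1} = insert b {a..<b}"
    by auto
  with step show ?case by simp
qed simp

lemma abs_diff_le_variation:
  fixes \<phi> :: "int \<Rightarrow> real"
  assumes "a \<le> b"
  shows "\<bar>\<phi> b - \<phi> a\<bar> \<le> (\<Sum>t\<in>{a..<b}. \<bar>\<phi> (t + 1) - \<phi> t\<bar>)"
  using sum_differences[OF assms, of \<phi>] sum_abs[of "\<lambda>t. \<phi> (t + 1) - \<phi> t" "{a..<b}"] by simp

text \<open>The values start at 0, pass through those at \<open>s\<close>, \<open>r\<close>,
  \<open>u\<close> and return to 0; the triangle inequality is applied to each of the four
  pieces.\<close>

lemma variation_ge_path:
  fixes \<phi> :: "int \<Rightarrow> real"
  assumes zero: "\<And>t. t \<notin> {a<..b} \<Longrightarrow> \<phi> t = 0" and le: "s \<le> r" "r \<le> u" and su: "s \<in> {a..b}" "u \<in> {a..b}"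
  shows "\<bar>\<phi> s\<bar> + \<bar>\<phi> r - \<phi> s\<bar> + \<bar>\<phi> u - \<phi> r\<bar> + \<bar>\<phi> u\<bar> \<le> (\<Sum>t\<in>{a..b}. \<bar>\<phi> (t + 1) - \<phi> t\<bar>)"
proof -
  have split: "(\<Sum>t\<in>{x..<z}. \<psi> t) = (\<Sum>t\<in>{x..<y}. \<psi> t) + (\<Sum>t\<in>{y..<z}. \<psi> t)"
    if "x \<le> y" "y \<le> z" for x y z :: int and \<psi> :: "int \<Rightarrow> real"
    using that by (subst sum.union_disjoint[symmetric]) (auto simp: ivl_disj_un)
  have *: "a \<le> s" "u \<le> b + 1"
    using su by auto
  have "{a..b} = {a..<b + 1}"
    by auto
  then have "(\<Sum>t\<in>{a..b}. \<bar>\<phi> (t + 1) - \<phi> t\<bar>)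
      = (\<Sum>t\<in>{a..<s}. \<bar>\<phi> (t + 1) - \<phi> t\<bar>) + (\<Sum>t\<in>{s..<r}. \<bar>\<phi> (t + 1) - \<phi> t\<bar>)
      + (\<Sum>t\<in>{r..<u}. \<bar>\<phi> (t + 1) - \<phi> t\<bar>) + (\<Sum>t\<in>{u..<b + 1}. \<bar>\<phi> (t + 1) - \<phi> t\<bar>)"
    using le * split[of a s "b + 1" "\<lambda>t. \<bar>\<phi> (t + 1) - \<phi> t\<bar>"]
      split[of s r "b + 1" "\<lambda>t. \<bar>\<phi> (t + 1) - \<phi> t\<bar>"]
      split[of r u "b + 1" "\<lambda>t. \<bar>\<phi> (t + 1) - \<phi> t\<bar>"]
    by simp
  \<comment> \<open>Since the support lies in \<open>{a<..b}\<close>, the sum over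
    \<open>{a..b}\<close> sees both the step leaving \<open>a\<close> and the step arriving at
    \<open>b + 1\<close>.\<close>
  moreover have "\<phi> a = 0" "\<phi> (b + 1) = 0"
    by (simp_all add: zero)
  ultimately show ?thesis
    using abs_diff_le_variation[OF *(1), of \<phi>] abs_diff_le_variation[OF le(1), of \<phi>]
      abs_diff_le_variation[OF le(2), of \<phi>] abs_diff_le_variation[OF *(2), of \<phi>]
    by simp
qed

lemma abs_le_half_variation:
  fixes \<phi> :: "int \<Rightarrow> real"
  assumes zero: "\<And>t. t \<notin> {a<..b} \<Longrightarrow> \<phi> t = 0"
  shows "\<bar>\<phi> s\<bar> \<le> (\<Sum>t\<in>{a..b}. \<bar>\<phi> (t + 1) - \<phi> t\<bar>) / 2"
proof (cases "s \<in> {a<..b}")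
  case True
  then show ?thesis
    using variation_ge_path[of a b \<phi> s s s] zero by auto
next
  case False
  then show ?thesis
    by (simp add: zero sum_nonneg)
qed

text \<open>The rise to \<open>\<phi> s\<close> and the return from \<open>\<phi> u\<close> use up
  the whole variation, so nothing is left for the steps in between.\<close>

lemma const_between_of_half_variation:
  fixes \<phi> :: "int \<Rightarrow> real"
  assumes zero: "\<And>t. t \<notin> {a<..b} \<Longrightarrow> \<phi> t = 0"
    and le: "s \<le> r" "r \<le> u" and su: "s \<in> {a..b}" "u \<in> {a..b}"
    and eq: "\<bar>\<phi> s\<bar> = (\<Sum>t\<in>{a..b}. \<bar>\<phi> (t + 1) - \<phi> t\<bar>) / 2"
      "\<bar>\<phi> u\<bar> = (\<Sum>t\<in>{a..b}. \<bar>\<phi> (t + 1) - \<phi> t\<bar>) / 2"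
  shows "\<phi> r = \<phi> s" "\<phi> u = \<phi> s"
  using variation_ge_path[where \<phi> = \<phi>, OF zero le su] eq by auto

text \<open>The only jumps are at \<open>c - 1\<close> and \<open>d\<close>, both inside the
  window.\<close>

lemma variation_indicator:
  fixes a b c d :: int
  assumes "a < c" "c \<le> d" "d \<le> b"
  shows "(\<Sum>t\<in>{a..b}. \<bar>indicator {c..d} (t + 1) - indicator {c..d} t :: real\<bar>) = 2"
proof -
  have "(\<Sum>t\<in>{a..b}. \<bar>indicator {c..d} (t + 1) - indicator {c..d} t :: real\<bar>)
      = (\<Sum>t\<in>{c - 1, d}. \<bar>indicator {c..d} (t + 1) - indicator {c..d} t\<bar>)"
    using assms by (intro sum.mono_neutral_right) (auto simp: indicator_def split: if_splits)
  then show ?thesis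
    using assms by (simp add: indicator_def)
qed

section \<open>The discrete Gagliardo--Nirenberg--Sobolev inequality\<close>

text \<open>With \<open>K = {a..b}\<close> and the support of \<open>f\<close> inside
  \<open>{a<..b}\<close> in every coordinate, the finite sum catches all nonzero differences on the
  line.\<close>

definition half_variation :: "int set \<Rightarrow> 'n \<Rightarrow> (int ^ 'n \<Rightarrow> real) \<Rightarrow> int ^ 'n \<Rightarrow> real" where
  "half_variation K i f z = (\<Sum>t\<in>K. \<bar>f (upd z i (t + 1)) - f (upd z i t)\<bar>) / 2"

lemma half_variation_nonneg: "0 \<le> half_variation K i f z"
  by (simp add: half_variation_def sum_nonneg)

lemma half_variation_upd: "half_variation K i f (upd z i t) = half_variation K i f z"
  by (simp add: half_variation_def)

lemma finite_support_bounds: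
  fixes f :: "int ^ 'n \<Rightarrow> real"
  assumes "f \<in> C0"
  obtains a b where "\<And>z. f z \<noteq> 0 \<Longrightarrow> \<forall>k. z $ k \<in> {a<..b}"
proof -
  define T where "T = (\<Union>k. (\<lambda>z. z $ k) ` {z. f z \<noteq> 0})"
  have "finite T"
    using assms by (auto simp: T_def C0_def)
  then have T: "finite (insert 0 T)"
    by simp
  \<comment> \<open>Inserting 0 keeps the set nonempty when \<open>f\<close> vanishes; the
    \<open>- 1\<close> makes the left end of the window open.\<close>
  have "Min (insert 0 T) - 1 < z $ k \<and> z $ k \<le> Max (insert 0 T)" if "f z \<noteq> 0" for z k
  proof -
    have "z $ k \<in> insert 0 T"
      using that by (auto simp: T_def)
    then show ?thesis
      using Min_le[OF T] Max_ge[OF T] by fastforce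
  qed
  then show ?thesis
    by (intro that[of "Min (insert 0 T) - 1" "Max (insert 0 T)"]) auto
qed

lemma partial_diff_eq: "partial_diff i f z = f (upd z i (z $ i + 1)) - f z"
proof -
  have "z + axis i 1 = upd z i (z $ i + 1)"
    by (simp add: vec_eq_iff axis_def)
  then show ?thesis
    by (simp add: partial_diff_def)
qed

section \<open>Norms as box sums over a window containing the support\<close>

context
  fixes f :: "int ^ 'n \<Rightarrow> real" and a b :: int
  assumes supp: "\<And>z. f z \<noteq> 0 \<Longrightarrow> \<forall>k. z $ k \<in> {a<..b}"
begin

lemma line_zero: "t \<notin> {a<..b} \<Longrightarrow> f (upd z i t) = 0"
  by (metis supp upd_nth)

lemma abs_le_half_variation_line: "\<bar>f z\<bar> \<le> half_variation {a..b} i f z"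
  using abs_le_half_variation[of a b "\<lambda>t. f (upd z i t)" "z $ i"] line_zero
  by (simp add: half_variation_def)

lemma infsum_eq_box_sum:
  fixes h :: "int ^ 'n \<Rightarrow> real"
  assumes "\<And>z. h z \<noteq> 0 \<Longrightarrow> \<forall>k. z $ k \<in> {a..b}"
  shows "infsum h UNIV = box_sum {a..b} UNIV h z0"
proof -
  have "infsum h UNIV = infsum h (box_at {a..b} UNIV z0)"
    using assms by (intro infsum_cong_neutral) (auto simp: box_at_def)
  then show ?thesis
    by (simp add: box_sum_def finite_box_at)
qed

lemma lp_norm_eq_box_sum:
  "lp_norm p f = box_sum {a..b} UNIV (\<lambda>w. \<bar>f w\<bar> powr p) z0 powr (1 / p)"
proof -
  have "\<forall>k. z $ k \<in> {a..b}" if "\<bar>f z\<bar> powr p \<noteq> 0" for z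
    using supp[of z] that by (simp add: less_imp_le)
  then show ?thesis
    unfolding lp_norm_def
    by (subst infsum_eq_box_sum[where h = "\<lambda>z. \<bar>f z\<bar> powr p" and ?z0.0 = z0]) auto
qed

text \<open>Summing along direction \<open>i\<close> first produces twice the half variation, which
  then remains to be summed over the other coordinates.\<close>

lemma lp_norm_partial_diff:
  "lp_norm 1 (partial_diff i f) = 2 * box_sum {a..b} (UNIV - {i}) (half_variation {a..b} i f) z0"
proof -
  have "\<forall>k. z $ k \<in> {a..b}" if "partial_diff i f z \<noteq> 0" for z
  proof (cases "f z = 0")
    \<comment> \<open>Here the shifted point is in the support, so \<open>z $ i\<close> may equal
      \<open>a\<close>; this is why the sums run over the closed interval.\<close>
    case True
    then have "f (upd z i (z $ i + 1)) \<noteq> 0"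
      using that by (simp add: partial_diff_eq)
    note shifted = supp[OF this]
    show ?thesis
    proof
      fix k
      show "z $ k \<in> {a..b}"
        using shifted[THEN spec, of k] by (cases "k = i") auto
    qed
  next
    case False
    from supp[OF this] show ?thesis
      by (auto simp: less_imp_le)
  qed
  then have "infsum (\<lambda>z. \<bar>partial_diff i f z\<bar>) UNIV
      = box_sum {a..b} (insert i (UNIV - {i})) (\<lambda>z. \<bar>partial_diff i f z\<bar>) z0"
    by (subst infsum_eq_box_sum) (auto simp: insert_absorb)
  also have "\<dots> = box_sum {a..b} (UNIV - {i}) (\<lambda>z. 2 * half_variation {a..b} i f z) z0"
    by (subst box_sum_insert) (auto simp: partial_diff_eq half_variation_def)
  also have "\<dots> = 2 * box_sum {a..b} (UNIV - {i}) (half_variation {a..b} i f) z0"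
    by (simp add: box_sum_def sum_distrib_left)
  finally show ?thesis
    by (simp add: lp_norm_def box_sum_nonneg half_variation_nonneg)
qed

lemma Gagliardo_Nirenberg_box_sum:
  assumes "CARD('n) \<ge> 2"
  shows "box_sum {a..b} UNIV (\<lambda>w. \<bar>f w\<bar> powr (real CARD('n) / (real CARD('n) - 1))) z
    \<le> (\<Prod>j\<in>UNIV. box_sum {a..b} (UNIV - {j}) (half_variation {a..b} j f) z
          powr (1 / (real CARD('n) - 1)))"
  by (intro Loomis_Whitney_dominated assms)
    (auto simp: half_variation_upd abs_le_half_variation_line)

section \<open>The equality case: multiples of indicators of cuboids\<close>

lemma cuboid_of_equality:
  assumes n: "CARD('n) \<ge> 2"
    and eq: "box_sum {a..b} UNIV (\<lambda>w. \<bar>f w\<bar> powr (real CARD('n) / (real CARD('n) - 1))) z0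
    = (\<Prod>j\<in>UNIV. box_sum {a..b} (UNIV - {j}) (half_variation {a..b} j f) z0
          powr (1 / (real CARD('n) - 1)))"
    and nz: "f w0 \<noteq> 0"
  shows "\<exists>A. is_cuboid A \<and> f = (\<lambda>z. f w0 * indicator A z)"
proof -
  have K: "z $ k \<in> {a..b}" if "f z \<noteq> 0" for z k
    using supp[OF that] by (simp add: less_imp_le)
  have slice: "\<bar>f v\<bar> = half_variation {a..b} i f v"
    if "f z \<noteq> 0" "\<And>k. v $ k \<in> {a..b}" "v $ i = z $ i" for z v i
    using that K eq
    by (intro Loomis_Whitney_dominated_equality[OF n, of "{a..b}" "\<lambda>j. half_variation {a..b} j f"
          "\<lambda>w. \<bar>f w\<bar>" z0 z v i])
      (auto simp: half_variation_upd abs_le_half_variation_line)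
  have exchange: "f (upd z i t) = f z"
    if z: "f z \<noteq> 0" and s: "f s \<noteq> 0" and u: "f u \<noteq> 0" and t: "s $ i \<le> t" "t \<le> u $ i" for z s u i t
  proof -
    define \<phi> where "\<phi> t = f (upd z i t)" for t
    \<comment> \<open>The support point \<open>w\<close> may lie on another line:
      \<open>slice\<close> covers every point of the box with the same \<open>i\<close>-th
      coordinate, so it transfers \<open>w $ i\<close> to the line through \<open>z\<close>.\<close>
    have half: "\<bar>\<phi> (w $ i)\<bar> = (\<Sum>t\<in>{a..b}. \<bar>\<phi> (t + 1) - \<phi> t\<bar>) / 2" if "f w \<noteq> 0" for w
      using slice[OF that, of "upd z i (w $ i)" i] K[OF z] K[OF that]
      by (simp add: \<phi>_def half_variation_def)
    have zero: "\<phi> t = 0" if "t \<notin> {a<..b}" for t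
      using that by (simp add: \<phi>_def line_zero)
    have eq: "\<phi> r = \<phi> (x $ i)" "\<phi> (y $ i) = \<phi> (x $ i)"
      if "f x \<noteq> 0" "f y \<noteq> 0" "x $ i \<le> r" "r \<le> y $ i" for x y r
      using const_between_of_half_variation[of a b \<phi> "x $ i" r "y $ i"] zero that K half by blast+
    \<comment> \<open>Whichever coordinate is smaller serves as the left end.\<close>
    have "\<phi> (z $ i) = \<phi> (s $ i)"
      using eq(2)[OF z s, of "z $ i"] eq(2)[OF s z, of "z $ i"] by linarith
    moreover have "\<phi> t = \<phi> (s $ i)"
      using eq(1)[OF s u t] .
    ultimately show ?thesis
      by (simp add: \<phi>_def)
  qed
  define S where "S k = (\<lambda>z. z $ k) ` {z. f z \<noteq> 0}" for k
  define lo where "lo = (\<chi> k. Min (S k))"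
  define hi where "hi = (\<chi> k. Max (S k))"
  \<comment> \<open>The bounding box of the support; its extreme coordinates may be attained at
    different support points.\<close>
  define A where "A = {z. \<forall>k. z $ k \<in> {lo $ k..hi $ k}}"
  have fin: "finite (S k)" for k
    by (rule finite_subset[of _ "{a..b}"]) (use K in \<open>auto simp: S_def\<close>)
  have ne: "S k \<noteq> {}" for k
    using nz by (auto simp: S_def)
  have supp_A: "z \<in> A" if "f z \<noteq> 0" for z
    using that fin by (auto simp: A_def lo_def hi_def S_def)
  have on_A: "f z = f w0" if z: "z \<in> A" for z
  proof -
    \<comment> \<open>Walk from \<open>w0\<close> to \<open>z\<close> one coordinate at a time. The
      value stays \<open>f w0\<close>, hence nonzero, so each intermediate point is in the support
      and \<open>exchange\<close> applies again.\<close>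
    have "f (\<chi> k. if k \<in> J then z $ k else w0 $ k) = f w0" for J
    proof -
      have "finite J" by simp
      then show ?thesis
      proof (induction J)
        case (insert i J)
        define w where "w = (\<chi> k. if k \<in> J then z $ k else w0 $ k)"
        have "lo $ i \<in> S i" "hi $ i \<in> S i"
          using fin ne by (simp_all add: lo_def hi_def)
        then obtain s u where "f s \<noteq> 0" "s $ i = lo $ i" "f u \<noteq> 0" "u $ i = hi $ i"
          by (auto simp: S_def)
        then have "f (upd w i (z $ i)) = f w"
          using z nz insert.IH by (intro exchange[of w s u]) (auto simp: w_def A_def)
        moreover have "upd w i (z $ i) = (\<chi> k. if k \<in> insert i J then z $ k else w0 $ k)"
          by (auto simp: w_def vec_eq_iff)
        ultimately show ?case
          using insert.IH by (simp add: w_def)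
      qed simp
    qed
    from this[of UNIV] show ?thesis by simp
  qed
  have "lo $ k \<le> hi $ k" for k
    using supp_A[OF nz] by (auto simp: A_def intro: order_trans)
  then have "is_cuboid A"
    by (auto simp: is_cuboid_def A_def)
  moreover have "f = (\<lambda>z. f w0 * indicator A z)"
    using supp_A on_A by (auto simp: indicator_def fun_eq_iff)
  ultimately show ?thesis by blast
qed

text \<open>Everything factors into the side lengths \<open>L k\<close>. Half variation in direction
  \<open>i\<close> drops the \<open>i\<close>-th factor, so each \<open>L k\<close> occurs
  \<open>n - 1\<close> times on the right, which the exponent \<open>1 / (n - 1)\<close>
  undoes.\<close>

lemma equality_of_cuboid:
  assumes n: "CARD('n) \<ge> 2" and A: "is_cuboid A" and f: "f = (\<lambda>z. c * indicator A z)" and c: "c \<noteq> 0"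
  shows "box_sum {a..b} UNIV (\<lambda>w. \<bar>f w\<bar> powr (real CARD('n) / (real CARD('n) - 1))) z0
    = (\<Prod>j\<in>UNIV. box_sum {a..b} (UNIV - {j}) (half_variation {a..b} j f) z0
          powr (1 / (real CARD('n) - 1)))"
proof -
  define r where "r = 1 / (real CARD('n) - 1)"
  define p where "p = real CARD('n) / (real CARD('n) - 1)"
  obtain lo hi where lohi: "\<And>k. lo $ k \<le> hi $ k" and A: "A = {z. \<forall>k. z $ k \<in> {lo $ k..hi $ k}}"
    using A by (auto simp: is_cuboid_def)
  define \<phi> :: "'n \<Rightarrow> int \<Rightarrow> real" where "\<phi> k = indicator {lo $ k..hi $ k}" for k
  define L where "L k = (\<Sum>t\<in>{a..b}. \<phi> k t)" for k
  have L: "0 \<le> L k" for k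
    by (simp add: L_def \<phi>_def sum_nonneg)
  have ind: "indicator A z = (\<Prod>k\<in>UNIV. \<phi> k (z $ k))" for z
    by (auto simp: A \<phi>_def indicator_def)
  \<comment> \<open>As \<open>c\<close> is nonzero, the two corners lie in the support, which places
    the cuboid and its boundary jumps within the window.\<close>
  have "lo \<in> A" "hi \<in> A"
    using lohi by (auto simp: A)
  then have "f lo \<noteq> 0" "f hi \<noteq> 0"
    using c by (simp_all add: f)
  then have bounds: "a < lo $ k" "hi $ k \<le> b" for k
    using supp by auto
  have var: "half_variation {a..b} i f z = \<bar>c\<bar> * (\<Prod>k\<in>UNIV - {i}. \<phi> k (z $ k))" for i z
  proof -
    define P where "P = (\<Prod>k\<in>UNIV - {i}. \<phi> k (z $ k))"
    have P: "0 \<le> P"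
      by (simp add: P_def \<phi>_def prod_nonneg)
    have "f (upd z i t) = c * P * \<phi> i t" for t
    proof -
      have "(\<Prod>k\<in>UNIV. \<phi> k (upd z i t $ k)) = \<phi> i t * (\<Prod>k\<in>UNIV - {i}. \<phi> k (upd z i t $ k))"
        by (subst prod.remove[of _ i]) auto
      also have "(\<Prod>k\<in>UNIV - {i}. \<phi> k (upd z i t $ k)) = P"
        unfolding P_def by (intro prod.cong) auto
      finally show ?thesis
        by (simp add: f ind)
    qed
    then have "half_variation {a..b} i f z = (\<Sum>t\<in>{a..b}. \<bar>c\<bar> * P * \<bar>\<phi> i (t + 1) - \<phi> i t\<bar>) / 2"
      using P by (simp add: half_variation_def abs_mult flip: right_diff_distrib)
    also have "\<dots> = \<bar>c\<bar> * P * (\<Sum>t\<in>{a..b}. \<bar>\<phi> i (t + 1) - \<phi> i t\<bar>) / 2"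
      by (simp add: sum_distrib_left)
    also have "\<dots> = \<bar>c\<bar> * P"
      using variation_indicator[OF bounds(1) lohi bounds(2)] by (simp add: \<phi>_def)
    finally show ?thesis
      by (simp add: P_def)
  qed
  have scale: "box_sum {a..b} I (\<lambda>w. C * (\<Prod>k\<in>I. \<phi> k (w $ k))) z0 = C * (\<Prod>k\<in>I. L k)" for I C
    unfolding L_def box_sum_prod[of "{a..b}" I \<phi> z0, symmetric]
    by (simp only: box_sum_def sum_distrib_left)
  have "\<bar>f w\<bar> powr p = \<bar>c\<bar> powr p * (\<Prod>k\<in>UNIV. \<phi> k (w $ k))" for w
    by (simp add: f indicator_def flip: ind)
  then have lhs: "box_sum {a..b} UNIV (\<lambda>w. \<bar>f w\<bar> powr p) z0 = \<bar>c\<bar> powr p * (\<Prod>k\<in>UNIV. L k)"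
    by (simp add: scale)
  have marginal: "box_sum {a..b} (UNIV - {j}) (half_variation {a..b} j f) z0
      = \<bar>c\<bar> * (\<Prod>k\<in>UNIV - {j}. L k)" for j
  proof -
    have "half_variation {a..b} j f = (\<lambda>z. \<bar>c\<bar> * (\<Prod>k\<in>UNIV - {j}. \<phi> k (z $ k)))"
      by (rule ext) (rule var)
    then show ?thesis
      by (simp only: scale)
  qed
  \<comment> \<open>Double counting: \<open>L k\<close> is a factor for every \<open>j\<close> other
    than \<open>k\<close>.\<close>
  have "(\<Prod>j\<in>(UNIV :: 'n set). \<Prod>k\<in>UNIV - {j}. L k) = (\<Prod>k\<in>UNIV. L k) ^ (CARD('n) - 1)"
  proof -
    have "(\<Prod>j\<in>(UNIV :: 'n set). \<Prod>k\<in>UNIV - {j}. L k) = (\<Prod>j\<in>(UNIV :: 'n set). \<Prod>k\<in>{k\<in>UNIV. k \<noteq> j}. L k)"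
      by (intro prod.cong) auto
    also have "\<dots> = (\<Prod>k\<in>(UNIV :: 'n set). \<Prod>j\<in>{j\<in>UNIV. k \<noteq> j}. L k)"
      by (rule prod.swap_restrict) auto
    also have "\<dots> = (\<Prod>k\<in>(UNIV :: 'n set). L k ^ (CARD('n) - 1))"
    proof (rule prod.cong[OF refl])
      fix k :: 'n
      have "{j\<in>UNIV. k \<noteq> j} = UNIV - {k}" by auto
      then show "(\<Prod>j\<in>{j\<in>UNIV. k \<noteq> j}. L k) = L k ^ (CARD('n) - 1)"
        by simp
    qed
    finally show ?thesis
      by (simp add: prod_power_distrib)
  qed
  then have "(\<Prod>j\<in>UNIV. box_sum {a..b} (UNIV - {j}) (half_variation {a..b} j f) z0 powr r)
      = (\<Prod>j\<in>(UNIV :: 'n set). \<bar>c\<bar> powr r) * ((\<Prod>k\<in>UNIV. L k) ^ (CARD('n) - 1)) powr r"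
    by (simp add: marginal powr_mult prod.distrib prod_powr prod_nonneg L del: prod_constant)
  also have "(\<Prod>j\<in>(UNIV :: 'n set). \<bar>c\<bar> powr r) = \<bar>c\<bar> powr p"
    unfolding r_def p_def by (rule powr_eq_prod_powr[OF n, symmetric]) simp
  also have "((\<Prod>k\<in>UNIV. L k) ^ (CARD('n) - 1)) powr r = (\<Prod>k\<in>UNIV. L k)"
  proof -
    have "real (CARD('n) - 1) * r = 1"
      using n by (simp add: r_def of_nat_diff)
    then show ?thesis
      using n L by (simp add: prod_nonneg powr_powr flip: powr_realpow')
  qed
  finally show ?thesis
    using lhs by (simp add: r_def p_def)
qed

end

theorem theorem1p1:
  fixes f :: "int ^ 'n \<Rightarrow> real"
  assumes "CARD('n) \<ge> 2"
    and "f \<in> C0"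
  shows "lp_norm (real CARD('n) / (real CARD('n) - 1)) f
           \<le> 1 / 2 * (\<Prod>i\<in>UNIV. lp_norm 1 (partial_diff i f) powr (1 / real CARD('n)))
       \<and> (lp_norm (real CARD('n) / (real CARD('n) - 1)) f
           = 1 / 2 * (\<Prod>i\<in>UNIV. lp_norm 1 (partial_diff i f) powr (1 / real CARD('n)))
          \<longleftrightarrow> (\<exists>(c::real) A. is_cuboid A \<and> f = (\<lambda>z. c * indicator A z)))"
proof -
  define n where "n = real CARD('n)"
  have n: "n \<ge> 2"
    using assms(1) by (simp add: n_def)
  \<comment> \<open>The power \<open>q\<close> turns the box sum \<open>X\<close> into the norm of
    \<open>f\<close> and the exponents \<open>1 / (n - 1)\<close> into \<open>1 / n\<close>.\<close>
  define q where "q = 1 / (n / (n - 1))"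
  have q: "0 < q" "1 / (n - 1) * q = 1 / n"
    using n by (auto simp: q_def field_simps)
  obtain a b where supp: "\<And>z. f z \<noteq> 0 \<Longrightarrow> \<forall>k. z $ k \<in> {a<..b}"
    using finite_support_bounds[OF assms(2)] by blast
  define X where "X = box_sum {a..b} UNIV (\<lambda>w. \<bar>f w\<bar> powr (n / (n - 1))) 0"
  define G where "G j = box_sum {a..b} (UNIV - {j}) (half_variation {a..b} j f) 0" for j
  define Y where "Y = (\<Prod>j\<in>UNIV. G j powr (1 / (n - 1)))"
  have nonneg: "0 \<le> X" "0 \<le> G j" "0 \<le> Y" for j
    by (simp_all add: X_def G_def Y_def box_sum_nonneg half_variation_nonneg prod_nonneg)
  have lhs: "lp_norm (n / (n - 1)) f = X powr q"
    unfolding X_def q_def by (rule lp_norm_eq_box_sum[OF supp])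
  \<comment> \<open>Each norm is twice \<open>G i\<close>; the \<open>n\<close> factors
    \<open>2 powr (1 / n)\<close> multiply to 2 and cancel the constant
    \<open>1 / 2\<close>.\<close>
  have "(\<Prod>i\<in>UNIV. lp_norm 1 (partial_diff i f) powr (1 / n))
      = (\<Prod>i\<in>(UNIV :: 'n set). 2 powr (1 / n)) * (\<Prod>i\<in>UNIV. G i powr (1 / n))"
    using nonneg by (simp add: lp_norm_partial_diff[OF supp, where ?z0.0 = 0] powr_mult prod.distrib flip: G_def)
  also have "(\<Prod>i\<in>(UNIV :: 'n set). 2 powr (1 / n)) = 2"
    using n by (simp add: powr_power n_def)
  also have "(\<Prod>i\<in>UNIV. G i powr (1 / n)) = Y powr q"
    unfolding Y_def q(2)[symmetric] by (simp add: prod_powr powr_powr flip: prod_powr)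
  finally have rhs: "1 / 2 * (\<Prod>i\<in>UNIV. lp_norm 1 (partial_diff i f) powr (1 / n)) = Y powr q"
    by simp
  have "X \<le> Y"
    unfolding X_def Y_def G_def n_def by (rule Gagliardo_Nirenberg_box_sum[OF supp assms(1)])
  then have le: "X powr q \<le> Y powr q"
    using q nonneg by (intro powr_mono2) auto
  \<comment> \<open>A positive power is strictly increasing, so equality of the norms amounts to
    equality of the box sums.\<close>
  have "X powr q = Y powr q \<longleftrightarrow> X = Y"
    using q nonneg by (metis powr_less_mono2 linorder_neq_iff)
  also have "\<dots> \<longleftrightarrow> (\<exists>(c::real) A. is_cuboid A \<and> f = (\<lambda>z. c * indicator A z))"
  proof
    assume eq: "X = Y"
    show "\<exists>(c::real) A. is_cuboid A \<and> f = (\<lambda>z. c * indicator A z)"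
    proof (cases "f = (\<lambda>z. 0)")
      case True
      \<comment> \<open>Cuboids are nonempty, so the zero function is written as 0 times the
        indicator of the origin.\<close>
      have "is_cuboid {z :: int ^ 'n. \<forall>i. z $ i \<in> {0 $ i..0 $ i}}"
        unfolding is_cuboid_def by (intro exI[of _ 0]) simp
      moreover have "f = (\<lambda>z. 0 * indicator {z. \<forall>i. z $ i \<in> {0 $ i..0 $ i}} z)"
        using True by simp
      ultimately show ?thesis by blast
    next
      case False
      then obtain w0 where "f w0 \<noteq> 0" by auto
      then show ?thesis
        using cuboid_of_equality[OF supp assms(1), where ?z0.0 = 0 and ?w0.0 = w0] eq
        unfolding X_def Y_def G_def n_def by blast
    qed
  next
    assume "\<exists>(c::real) A. is_cuboid A \<and> f = (\<lambda>z. c * indicator A z)"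
    then obtain c A where A: "is_cuboid A" "f = (\<lambda>z. c * indicator A z)"
      by blast
    show "X = Y"
    proof (cases "c = 0")
      case True
      then have "f = (\<lambda>z. 0)"
        using A by simp
      then show ?thesis
        using n by (simp add: X_def Y_def G_def box_sum_def half_variation_def)
    next
      case False
      then show ?thesis
        using equality_of_cuboid[OF supp assms(1) A False, where ?z0.0 = 0]
        by (simp add: X_def Y_def G_def n_def)
    qed
  qed
  finally show ?thesis
    using le lhs rhs unfolding n_def by simp
qed

end
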